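(* For every $s\in\mathbb{N}$ there exists a graph $G$ with $\operatorname{qn}(G)\leqslant 4$ and $\operatorname{sn}(G)>s$.
   Context: Graphs are finite, simple and undirected. Let $G$ be a graph and let $\prec$ be a (strict) total order on $V(G)$. Two disjoint edges $vw,xy\in E(G)$ (edges with no common endpoint) with $v\prec w$ and $x\prec y$ \emph{cross} with respect to $\prec$ if $v\prec x\prec w\prec y$ or $x\prec v\prec y\prec w$, and \emph{nest} with respect to $\prec$ if $v\prec x\prec y\prec w$ or $x\prec v\prec w\prec y$. For a function $\varphi:E(G)\to\{1,\ldots,k\}$ with $k\in\mathbb{N}$, the pair $(\prec,\varphi)$ is a \emph{$k$-stack layout} of $G$ if $vw$ and $xy$ do not cross for all edges $vw,xy\in E(G)$ with $\varphi(vw)=\varphi(xy)$; it is a \emph{$k$-queue layout} of $G$ if $vw$ and $xy$ do not nest for all edges $vw,xy\in E(G)$ with $\varphi(vw)=\varphi(xy)$. The \emph{stack-number} $\operatorname{sn}(G)$ is the smallest integer $s$ for which $G$ has an $s$-stack layout. The \emph{queue-number} $\operatorname{qn}(G)$ is the smallest integer $q$ for which $G$ has a $q$-queue layout. *)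

theory Defs
  imports Main
begin

text \<open>
  A graph is given by its vertex set \<open>V\<close> and its edge set \<open>E\<close>; the edge \<open>vw\<close> is the
  two-element set \<open>{v, w}\<close>.
\<close>

locale finite_simple_graph =
  fixes V :: "'a set" and E :: "'a set set"
  assumes finite_V: "finite V"
    and edges: "\<And>e. e \<in> E \<Longrightarrow> e \<subseteq> V \<and> card e = 2"

text \<open>
  A pair \<open>(a, b) \<in> r\<close> stands for \<open>a \<prec> b\<close>.
\<close>

definition cross :: "'a rel \<Rightarrow> 'a set \<Rightarrow> 'a set \<Rightarrow> bool" where
  "cross r e f \<longleftrightarrow> e \<inter> f = {} \<and>
    (\<exists>v w x y. e = {v, w} \<and> f = {x, y} \<and> (v, w) \<in> r \<and> (x, y) \<in> r \<and>
      ((v, x) \<in> r \<and> (x, w) \<in> r \<and> (w, y) \<in> r \<or>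
       (x, v) \<in> r \<and> (v, y) \<in> r \<and> (y, w) \<in> r))"

definition nest :: "'a rel \<Rightarrow> 'a set \<Rightarrow> 'a set \<Rightarrow> bool" where
  "nest r e f \<longleftrightarrow> e \<inter> f = {} \<and>
    (\<exists>v w x y. e = {v, w} \<and> f = {x, y} \<and> (v, w) \<in> r \<and> (x, y) \<in> r \<and>
      ((v, x) \<in> r \<and> (x, y) \<in> r \<and> (y, w) \<in> r \<or>
       (x, v) \<in> r \<and> (v, w) \<in> r \<and> (w, y) \<in> r))"

definition stack_layout ::
    "nat \<Rightarrow> 'a set \<Rightarrow> 'a set set \<Rightarrow> 'a rel \<Rightarrow> ('a set \<Rightarrow> nat) \<Rightarrow> bool" where
  "stack_layout k V E r \<phi> \<longleftrightarrow> r \<subseteq> V \<times> V \<and> strict_linear_order_on V r \<and> \<phi> ` E \<subseteq> {1..k} \<and>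
    (\<forall>e\<in>E. \<forall>f\<in>E. \<phi> e = \<phi> f \<longrightarrow> \<not> cross r e f)"

definition queue_layout ::
    "nat \<Rightarrow> 'a set \<Rightarrow> 'a set set \<Rightarrow> 'a rel \<Rightarrow> ('a set \<Rightarrow> nat) \<Rightarrow> bool" where
  "queue_layout k V E r \<phi> \<longleftrightarrow> r \<subseteq> V \<times> V \<and> strict_linear_order_on V r \<and> \<phi> ` E \<subseteq> {1..k} \<and>
    (\<forall>e\<in>E. \<forall>f\<in>E. \<phi> e = \<phi> f \<longrightarrow> \<not> nest r e f)"

definition stack_number :: "'a set \<Rightarrow> 'a set set \<Rightarrow> nat" where
  "stack_number V E = (LEAST s. \<exists>r \<phi>. stack_layout s V E r \<phi>)"

definition queue_number :: "'a set \<Rightarrow> 'a set set \<Rightarrow> nat" where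
  "queue_number V E = (LEAST q. \<exists>r \<phi>. queue_layout q V E r \<phi>)"

text \<open>
  Every finite graph has stack and queue layouts (give each edge its own colour), so both
  minima are attained.
\<close>

context finite_simple_graph
begin

lemma finite_E: "finite E"
  using finite_V edges by (meson Pow_iff finite_Pow_iff finite_subset subsetI)

lemma ex_strict_order: "\<exists>r. r \<subseteq> V \<times> V \<and> strict_linear_order_on V r"
proof -
  obtain g :: "'a \<Rightarrow> nat" where g: "inj_on g V"
    using finite_V finite_imp_inj_to_nat_seg by blast
  let ?r = "{(a, b). a \<in> V \<and> b \<in> V \<and> g a < g b}"
  have "strict_linear_order_on V ?r"
    unfolding strict_linear_order_on_def
  proof (intro conjI)
    show "trans ?r" by (auto intro: transI)
    show "irrefl ?r" by (auto intro: irreflI)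
    show "total_on V ?r"
      using g by (auto simp: total_on_def inj_on_def) (metis linorder_neqE_nat)
  qed
  moreover have "?r \<subseteq> V \<times> V" by auto
  ultimately show ?thesis by blast
qed

lemma ex_edge_colouring: "\<exists>\<phi> :: 'a set \<Rightarrow> nat. \<phi> ` E \<subseteq> {1..card E} \<and> inj_on \<phi> E"
proof -
  obtain h where "bij_betw h E {1..card E}"
    using finite_same_card_bij[OF finite_E, of "{1..card E}"] by auto
  then show ?thesis by (auto simp: bij_betw_def)
qed

lemma not_cross_refl: "e \<in> E \<Longrightarrow> \<not> cross r e e"
  by (auto simp: cross_def)

lemma not_nest_refl: "e \<in> E \<Longrightarrow> \<not> nest r e e"
  by (auto simp: nest_def)

lemma stack_number_attained: "\<exists>r \<phi>. stack_layout (stack_number V E) V E r \<phi>"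
proof -
  have "\<exists>r \<phi>. stack_layout (card E) V E r \<phi>"
    using ex_strict_order ex_edge_colouring not_cross_refl
    unfolding stack_layout_def inj_on_def by metis
  then show ?thesis unfolding stack_number_def by (rule LeastI)
qed

lemma queue_number_attained: "\<exists>r \<phi>. queue_layout (queue_number V E) V E r \<phi>"
proof -
  have "\<exists>r \<phi>. queue_layout (card E) V E r \<phi>"
    using ex_strict_order ex_edge_colouring not_nest_refl
    unfolding queue_layout_def inj_on_def by metis
  then show ?thesis unfolding queue_number_def by (rule LeastI)
qed

end

end

theory Submission
  imports Defs "HOL-Library.Ramsey"
begin

text \<open>
  The graph is the Cartesian product of a large star and a triangular grid. Ordering it
  lexicographically, grid point first, makes each of the three kinds of grid edges a shift by a
  constant, so the star edges and the three shifts give four queues.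

  For a stack layout, Ramsey's theorem yields many leaves for which the colours of the star edges
  and of the grid edges do not depend on the leaf, and at each grid point the leaves occur either
  in the same order or in the reversed one. This two-colours the grid points; by the Hex lemma some
  monochromatic component is so large that it contains two points whose star edges have the same
  colour. Noncrossing of the grid edges spreads the order of the leaves along the component: after
  thinning out the leaves, all copies of an earlier leaf at the two points precede all copies of a
  later leaf. Four such leaves force a crossing of star edges.
\<close>

section \<open>The Hex lemma\<close>

definition bichromatic :: "nat \<Rightarrow> nat \<Rightarrow> nat" where
  "bichromatic a b = (if a = 0 \<and> b = 1 \<or> a = 1 \<and> b = 0 then 1 else 0)"

text \<open>The side between two equal labels counts 0, and the other two sides count the
  same.\<close>

lemma even_bichromatic_triangle:
  "a = b \<or> b = c \<or> a = c \<Longrightarrow> even (bichromatic a b + bichromatic b c + bichromatic a c)"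
  by (auto simp: bichromatic_def)

text \<open>Summed over all squares, each inner side is counted twice, so only the boundary survives
  modulo 2. The summation runs up each column, then across the columns.\<close>

lemma even_boundary_of_squares:
  fixes h v :: "nat \<Rightarrow> nat \<Rightarrow> nat"
  assumes square: "\<And>x y. x < n \<Longrightarrow> y < m \<Longrightarrow> even (h x y + h x (Suc y) + (v x y + v (Suc x) y))"
  shows "even ((\<Sum>x<n. h x 0 + h x m) + (\<Sum>y<m. v 0 y + v n y))"
proof -
  have column: "even (h x 0 + h x l + (\<Sum>y<l. v x y + v (Suc x) y))" if "x < n" "l \<le> m" for x l
    using \<open>l \<le> m\<close>
  proof (induction l)
    case (Suc l)
    then show ?case
      using square[OF \<open>x < n\<close>, of l] by auto
  qed simp
  have "even ((\<Sum>x<k. h x 0 + h x m) + (\<Sum>y<m. v 0 y + v k y))" if "k \<le> n" for k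
    using that
  proof (induction k)
    case 0
    then show ?case by (simp add: sum.distrib)
  next
    case (Suc k)
    then show ?case
      using column[of k m] by (auto simp: sum.distrib)
  qed
  then show ?thesis by simp
qed

text \<open>Without a three-labelled triangle, the number of boundary sides with labels 0 and 1
  would be even. Such sides occur only at the bottom, where the label starts at 0 and ends at 1, so
  their number is odd.\<close>

lemma sperner_square:
  fixes L :: "nat \<Rightarrow> nat \<Rightarrow> nat"
  assumes left: "\<And>y. y \<le> N \<Longrightarrow> L 0 y = 0"
    and bottom: "\<And>x. x \<le> N \<Longrightarrow> L x 0 = 0 \<or> L x 0 = 1"
    and right: "\<And>y. y \<le> N \<Longrightarrow> L N y \<noteq> 0"
    and top: "\<And>x. x \<le> N \<Longrightarrow> L x N \<noteq> 1"
  obtains x y where "x < N" "y < N" "L x y \<noteq> L (Suc x) (Suc y)"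
    "L x y \<noteq> L (Suc x) y \<and> L (Suc x) y \<noteq> L (Suc x) (Suc y) \<or>
     L x y \<noteq> L x (Suc y) \<and> L x (Suc y) \<noteq> L (Suc x) (Suc y)"
proof (rule ccontr)
  assume "\<not> thesis"
  with that have no_rainbow: "L x y = L (Suc x) (Suc y) \<or>
     (L x y = L (Suc x) y \<or> L (Suc x) y = L (Suc x) (Suc y)) \<and>
     (L x y = L x (Suc y) \<or> L x (Suc y) = L (Suc x) (Suc y))" if "x < N" "y < N" for x y
    using that by blast
  define h where "h x y = bichromatic (L x y) (L (Suc x) y)" for x y
  define v where "v x y = bichromatic (L x y) (L x (Suc y))" for x y
  have "even ((\<Sum>x<N. h x 0 + h x N) + (\<Sum>y<N. v 0 y + v N y))"
  proof (rule even_boundary_of_squares)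
    \<comment> \<open>The diagonal lies in both triangles of the square and cancels modulo
      2.\<close>
    fix x y assume "x < N" "y < N"
    with no_rainbow[of x y]
      even_bichromatic_triangle[of "L x y" "L (Suc x) y" "L (Suc x) (Suc y)"]
      even_bichromatic_triangle[of "L x y" "L x (Suc y)" "L (Suc x) (Suc y)"]
    show "even (h x y + h x (Suc y) + (v x y + v (Suc x) y))"
      unfolding h_def v_def by auto
  qed
  moreover have "h x N = 0" if "x < N" for x
    using top[of x] top[of "Suc x"] that by (auto simp: h_def bichromatic_def)
  moreover have "v 0 y = 0" "v N y = 0" if "y < N" for y
    using left[of y] left[of "Suc y"] right[of y] right[of "Suc y"] that
    by (auto simp: v_def bichromatic_def)
  ultimately have even: "even (\<Sum>x<N. h x 0)"
    by simp
  have "odd (\<Sum>x<n. h x 0) \<longleftrightarrow> L n 0 = 1" if "n \<le> N" for n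
    using that
  proof (induction n)
    case 0
    then show ?case using left[of 0] by simp
  next
    case (Suc n)
    then show ?case
      using bottom[of n] bottom[of "Suc n"] by (auto simp: h_def bichromatic_def)
  qed
  from this[of N] even right[of 0] bottom[of N] show False by simp
qed

section \<open>Monochromatic components on a Hex board\<close>

definition hex_edges :: "nat \<Rightarrow> (nat \<times> nat) rel" where
  "hex_edges N = {((x, y), (x', y')). x' \<le> N \<and> y' \<le> N \<and>
     (x' = Suc x \<and> y' = y \<or> x' = x \<and> y' = Suc y \<or> x' = Suc x \<and> y' = Suc y)}"

text \<open>Both directions of the oriented \<open>hex_edges\<close> are included, so that the
  reflexive transitive closure describes connected components.\<close>

definition monochromatic_edges :: "nat \<Rightarrow> (nat \<times> nat \<Rightarrow> bool) \<Rightarrow> (nat \<times> nat) rel" where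
  "monochromatic_edges N B = {(u, v) \<in> hex_edges N \<union> (hex_edges N)\<inverse>. B u = B v}"

lemma sym_monochromatic_edges: "sym (monochromatic_edges N B)"
  by (auto simp: monochromatic_edges_def sym_def)

lemma monochromatic_edges_subset:
  "monochromatic_edges N B \<subseteq> ({..N} \<times> {..N}) \<times> ({..N} \<times> {..N})"
  by (auto simp: monochromatic_edges_def hex_edges_def)

text \<open>
  Label the components by the side they touch (left, else bottom, else neither). Two vertices of
  each triangle share a component, so no triangle has three labels, against Sperner's lemma.
\<close>

lemma hex_lemma:
  obtains u v where "u \<in> {..N} \<times> {..N}" "(u, v) \<in> (monochromatic_edges N B)\<^sup>*"
    "fst u = 0 \<and> fst v = N \<or> snd u = 0 \<and> snd v = N"
proof (rule ccontr)
  assume neg: "\<not> thesis"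
  note connects = that
  let ?A = "monochromatic_edges N B"
  have sym: "(v, u) \<in> ?A\<^sup>*" if "(u, v) \<in> ?A\<^sup>*" for u v
    using that sym_rtrancl[OF sym_monochromatic_edges] by (meson symE)
  \<comment> \<open>The path is reversed because a label is witnessed by a path into the left or
    bottom side.\<close>
  have not_both: False
    if "(v, u) \<in> ?A\<^sup>*" "u \<in> {..N} \<times> {..N}"
      "fst u = 0 \<and> fst v = N \<or> snd u = 0 \<and> snd v = N" for u v
    using neg connects[of u v] that sym by blast
  define touches where "touches f u \<longleftrightarrow> (\<exists>v \<in> {..N} \<times> {..N}. (u, v) \<in> ?A\<^sup>* \<and> f v = 0)"
    for f :: "nat \<times> nat \<Rightarrow> nat" and u
  have touches_eq: "touches f u = touches f v" if "(u, v) \<in> ?A" for f u v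
  proof -
    have "(u, v) \<in> ?A\<^sup>*" using that by blast
    with sym show ?thesis
      unfolding touches_def by (meson rtrancl_trans)
  qed
  have touchesI: "touches f u" if "u \<in> {..N} \<times> {..N}" "f u = 0" for f u
    unfolding touches_def using that by blast
  define L where "L x y = (if touches fst (x, y) then 0 else if touches snd (x, y) then 1 else 2::nat)"
    for x y
  have L_eq: "L x y = L x' y'" if "((x, y), (x', y')) \<in> ?A" for x y x' y'
    using touches_eq[OF that] by (simp add: L_def)
  obtain x y where xy: "x < N" "y < N" "L x y \<noteq> L (Suc x) (Suc y)"
    "L x y \<noteq> L (Suc x) y \<and> L (Suc x) y \<noteq> L (Suc x) (Suc y) \<or>
     L x y \<noteq> L x (Suc y) \<and> L x (Suc y) \<noteq> L (Suc x) (Suc y)"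
  proof (rule sperner_square)
    show "L 0 y = 0" if "y \<le> N" for y
      using that touchesI[of "(0, y)" fst] by (simp add: L_def)
    show "L x 0 = 0 \<or> L x 0 = 1" if "x \<le> N" for x
      using that touchesI[of "(x, 0)" snd] by (simp add: L_def)
    show "L N y \<noteq> 0" if "y \<le> N" for y
    proof -
      have "\<not> touches fst (N, y)"
        using not_both[of "(N, y)"] unfolding touches_def by force
      then show ?thesis by (simp add: L_def)
    qed
    show "L x N \<noteq> 1" if "x \<le> N" for x
    proof -
      have "\<not> touches snd (x, N)"
        using not_both[of "(x, N)"] unfolding touches_def by force
      then show ?thesis by (simp add: L_def)
    qed
  qed
  have hex: "((x, y), (Suc x, Suc y)) \<in> hex_edges N" "((x, y), (Suc x, y)) \<in> hex_edges N"
    "((Suc x, y), (Suc x, Suc y)) \<in> hex_edges N" "((x, y), (x, Suc y)) \<in> hex_edges N"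
    "((x, Suc y), (Suc x, Suc y)) \<in> hex_edges N"
    using xy(1,2) by (auto simp: hex_edges_def)
  have "L a b = L a' b'" if "((a, b), (a', b')) \<in> hex_edges N" "B (a, b) = B (a', b')" for a b a' b'
    using L_eq that by (auto simp: monochromatic_edges_def)
  then have neq: "B p \<noteq> B q" if "(p, q) \<in> hex_edges N" "L (fst p) (snd p) \<noteq> L (fst q) (snd q)" for p q
    using that by (cases p, cases q) auto
  \<comment> \<open>Three different labels on a triangle would require three different truth values
    of \<open>B\<close>.\<close>
  have "B (x, y) \<noteq> B (Suc x, Suc y)"
    using neq[OF hex(1)] xy(3) by simp
  with xy(4) show False
    using neq[OF hex(2)] neq[OF hex(3)] neq[OF hex(4)] neq[OF hex(5)] by auto
qed

text \<open>A discrete intermediate value theorem: one edge raises a coordinate by at most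
  1.\<close>

lemma coordinate_path:
  assumes "(u, v) \<in> (monochromatic_edges N B)\<^sup>*" "f = fst \<or> f = snd" "f u = 0" "k \<le> f v"
  shows "\<exists>w. (u, w) \<in> (monochromatic_edges N B)\<^sup>* \<and> f w = k"
  using assms
proof (induction arbitrary: k rule: rtrancl_induct)
  case base
  then have "f u = k" by simp
  then show ?case by blast
next
  case (step v v')
  then have "f v' \<le> Suc (f v)"
    by (auto simp: monochromatic_edges_def hex_edges_def)
  with step.prems have "k \<le> f v \<or> k = f v'" by linarith
  then show ?case
    using step by (blast intro: rtrancl.rtrancl_into_rtrancl)
qed

text \<open>A component joining opposite sides meets each of the \<open>N + 1\<close> lines in between.\<close>

lemma hex_pigeonhole:
  assumes "\<sigma> ` ({..N} \<times> {..N}) \<subseteq> {1..N}"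
  obtains u v where "u \<in> {..N} \<times> {..N}" "v \<in> {..N} \<times> {..N}" "u \<noteq> v" "\<sigma> u = \<sigma> v"
    "(u, v) \<in> (monochromatic_edges N B)\<^sup>*"
proof -
  let ?A = "monochromatic_edges N B"
  obtain u v where uv: "u \<in> {..N} \<times> {..N}" "(u, v) \<in> ?A\<^sup>*"
    "fst u = 0 \<and> fst v = N \<or> snd u = 0 \<and> snd v = N"
    by (rule hex_lemma)
  then obtain f where f: "f = fst \<or> f = snd" "f u = 0" "f v = N" by blast
  obtain w where w: "(u, w k) \<in> ?A\<^sup>*" "f (w k) = k" if "k \<le> N" for k
    using coordinate_path[OF uv(2) f(1,2)] f(3) by metis
  have in_grid: "w k \<in> {..N} \<times> {..N}" if "k \<le> N" for k
    using w(1)[OF that]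
  proof cases
    case base
    with uv(1) show ?thesis by simp
  next
    case step
    with monochromatic_edges_subset[of N B] show ?thesis by (meson mem_Sigma_iff subsetD)
  qed
  have "\<not> inj_on (\<sigma> \<circ> w) {..N}"
  proof
    assume "inj_on (\<sigma> \<circ> w) {..N}"
    moreover have "(\<sigma> \<circ> w) ` {..N} \<subseteq> {1..N}"
      using assms in_grid by fastforce
    ultimately show False
      using card_inj_on_le[of "\<sigma> \<circ> w" "{..N}" "{1..N}"] by simp
  qed
  then obtain k l where "k \<le> N" "l \<le> N" "k \<noteq> l" "\<sigma> (w k) = \<sigma> (w l)"
    by (auto simp: inj_on_def)
  moreover from this have "(w k, w l) \<in> ?A\<^sup>*"
    using w(1) sym_rtrancl[OF sym_monochromatic_edges] by (meson rtrancl_trans symE)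
  moreover have "w k \<noteq> w l" using calculation w(2) by metis
  ultimately show thesis using that in_grid by blast
qed

section \<open>Ramsey's theorem for ordered pairs\<close>

text \<open>This is Ramsey's theorem for two-element sets: \<open>Min\<close> and \<open>Max\<close>
  recover the order of a pair, \<open>e\<close> numbers the colours, and \<open>a\<close> lists the
  homogeneous set increasingly.\<close>

lemma ramsey_ordered_pairs:
  fixes m :: nat
  assumes "finite C"
  shows "\<exists>n::nat. \<forall>f :: nat \<Rightarrow> nat \<Rightarrow> 'c. (\<forall>i j. i < j \<longrightarrow> j < n \<longrightarrow> f i j \<in> C) \<longrightarrow>
    (\<exists>a c. (\<forall>i<m. a i < n) \<and> (\<forall>i j. i < j \<longrightarrow> j < m \<longrightarrow> a i < a j \<and> f (a i) (a j) = c))"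
proof -
  obtain e :: "'c \<Rightarrow> nat" where e: "bij_betw e C {..<card C}"
    using ex_bij_betw_finite_nat[OF assms] by (auto simp: atLeast0LessThan)
  obtain n :: nat where n: "partn_lst {..<n} (replicate (card C) (m::nat)) 2"
    using ramsey_full by blast
  show ?thesis
  proof (intro exI[of _ n] allI impI)
    fix f :: "nat \<Rightarrow> nat \<Rightarrow> 'c"
    assume f: "\<forall>i j. i < j \<longrightarrow> j < n \<longrightarrow> f i j \<in> C"
    define g where "g X = e (f (Min X) (Max X))" for X
    have "g \<in> [{..<n}]\<^bsup>2\<^esup> \<rightarrow> {..<card C}"
    proof
      fix X assume "X \<in> [{..<n}]\<^bsup>2\<^esup>"
      then obtain i j where "X = {i, j}" "i < j" "j < n"
        by (auto simp: ordered_nsets_2_eq)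
      then show "g X \<in> {..<card C}"
        using f e by (auto simp: g_def bij_betw_def)
    qed
    with n obtain q H where "q < card C" and H: "H \<in> [{..<n}]\<^bsup>(replicate (card C) m ! q)\<^esup>"
      and gH: "g ` [H]\<^bsup>2\<^esup> \<subseteq> {q}"
      by (elim partn_lstE) auto
    then have H: "H \<subseteq> {..<n}" "finite H" "card H = m"
      by (auto simp: nsets_def)
    define a where "a i = sorted_list_of_set H ! i" for i
    have aH: "a i \<in> H" if "i < m" for i
      using that H by (metis a_def length_sorted_list_of_set nth_mem set_sorted_list_of_set)
    have a_less: "a i < a j" if "i < j" "j < m" for i j
      using that H strict_sorted_list_of_set[of H]
      by (auto simp: a_def sorted_wrt_iff_nth_less)
    have "f (a i) (a j) = inv_into C e q" if "i < j" "j < m" for i j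
    proof -
      have "{a i, a j} \<in> [H]\<^bsup>2\<^esup>"
        using aH a_less that by (metis doubleton_in_nsets_2 less_irrefl less_trans)
      then have "g {a i, a j} = q" using gH by blast
      moreover have "f (a i) (a j) \<in> C"
        using f a_less[OF that] aH[of j] H(1) that by auto
      moreover have "g {a i, a j} = e (f (a i) (a j))"
        using a_less[OF that] by (simp add: g_def)
      ultimately show ?thesis
        using e by (metis bij_betw_inv_into_left)
    qed
    then show "\<exists>a c. (\<forall>i<m. a i < n) \<and> (\<forall>i j. i < j \<longrightarrow> j < m \<longrightarrow> a i < a j \<and> f (a i) (a j) = c)"
      using aH H(1) a_less by (intro exI[of _ a] exI[of _ "inv_into C e q"]) auto
  qed
qed

section \<open>Stack layouts\<close>

lemma stack_layout_mono: "stack_layout t V E r \<phi> \<Longrightarrow> t \<le> s \<Longrightarrow> stack_layout s V E r \<phi>"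
  by (fastforce simp: stack_layout_def)

lemma stack_layout_trans: "stack_layout t V E r \<phi> \<Longrightarrow> (a, b) \<in> r \<Longrightarrow> (b, c) \<in> r \<Longrightarrow> (a, c) \<in> r"
  by (auto simp: stack_layout_def strict_linear_order_on_def elim: transE)

lemma stack_layout_total:
  "stack_layout t V E r \<phi> \<Longrightarrow> a \<in> V \<Longrightarrow> b \<in> V \<Longrightarrow> a \<noteq> b \<Longrightarrow> (a, b) \<in> r \<or> (b, a) \<in> r"
  by (auto simp: stack_layout_def strict_linear_order_on_def total_on_def)

lemma stack_layout_in_V: "stack_layout t V E r \<phi> \<Longrightarrow> (a, b) \<in> r \<Longrightarrow> a \<in> V \<and> b \<in> V"
  by (auto simp: stack_layout_def)

text \<open>Disjointness of the two edges follows from the order hypotheses by irreflexivity and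
  transitivity, so one alternating pattern suffices.\<close>

lemma stack_layout_noncrossing:
  assumes layout: "stack_layout t V E r \<phi>"
    and "{a, b} \<in> E" "{c, d} \<in> E" "\<phi> {a, b} = \<phi> {c, d}"
    and ord: "(a, c) \<in> r" "(c, b) \<in> r" "(b, d) \<in> r"
  shows False
proof -
  note trans = stack_layout_trans[OF layout]
  have "irrefl r" using layout by (simp add: stack_layout_def strict_linear_order_on_def)
  then have "a \<noteq> c" "a \<noteq> d" "b \<noteq> c" "b \<noteq> d"
    using ord trans by (metis irreflD)+
  moreover have "(a, b) \<in> r" "(c, d) \<in> r" using ord trans by blast+
  ultimately have "cross r {a, b} {c, d}"
    using ord unfolding cross_def by blast
  with assms show False by (auto simp: stack_layout_def)
qed

text \<open>Otherwise \<open>h\<close>, \<open>h'\<close>, \<open>g\<close>, \<open>g'\<close> occur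
  in this order and the two edges cross. This carries the order of two leaves across a grid
  edge.\<close>

lemma stack_layout_adjacent_copies:
  assumes layout: "stack_layout t V E r \<phi>"
    and edges: "{g, h} \<in> E" "{g', h'} \<in> E" "\<phi> {g, h} = \<phi> {g', h'}"
    and ord: "(g, g') \<in> r" "(h, h') \<in> r" "g \<noteq> h'"
  shows "(g, h') \<in> r"
proof (rule ccontr)
  assume "(g, h') \<notin> r"
  then have "(h', g) \<in> r"
    using ord stack_layout_in_V[OF layout] stack_layout_total[OF layout] by blast
  then show False
    using stack_layout_noncrossing[OF layout, of h g h' g'] edges ord by (simp add: insert_commute)
qed

text \<open>
  Were the centre \<open>x\<close> before \<open>y\<close>, the noncrossing condition would place \<open>x\<close> before the second
  column and \<open>y\<close> after the third one, where the edges \<open>x p\<^sub>2\<close> and \<open>y q\<^sub>1\<close> cross.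
\<close>

lemma stack_layout_four_columns:
  assumes layout: "stack_layout t V E r \<phi>"
    and edges: "{x, p\<^sub>0} \<in> E" "{x, p\<^sub>2} \<in> E" "{y, q\<^sub>1} \<in> E" "{y, q\<^sub>3} \<in> E"
    and colour: "\<phi> {x, p\<^sub>0} = c" "\<phi> {x, p\<^sub>2} = c" "\<phi> {y, q\<^sub>1} = c" "\<phi> {y, q\<^sub>3} = c"
    and ord: "(p\<^sub>0, q\<^sub>1) \<in> r" "(q\<^sub>1, p\<^sub>2) \<in> r" "(p\<^sub>2, q\<^sub>3) \<in> r"
    and "q\<^sub>1 \<noteq> x" "p\<^sub>2 \<noteq> y"
  shows "(x, y) \<notin> r"
proof
  assume xy: "(x, y) \<in> r"
  note noncrossing = stack_layout_noncrossing[OF layout]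
  have "(q\<^sub>1, x) \<notin> r"
    using noncrossing[of p\<^sub>0 x q\<^sub>1 y] edges colour ord xy by (auto simp: insert_commute)
  then have xq: "(x, q\<^sub>1) \<in> r"
    using stack_layout_total[OF layout] stack_layout_in_V[OF layout] xy ord \<open>q\<^sub>1 \<noteq> x\<close> by blast
  have "(y, p\<^sub>2) \<notin> r"
    using noncrossing[of x p\<^sub>2 y q\<^sub>3] edges colour ord xy by auto
  then have "(p\<^sub>2, y) \<in> r"
    using stack_layout_total[OF layout] stack_layout_in_V[OF layout] xy ord \<open>p\<^sub>2 \<noteq> y\<close> by blast
  with xq show False
    using noncrossing[of x p\<^sub>2 q\<^sub>1 y] edges colour ord by (auto simp: insert_commute)
qed

text \<open>
  \<open>node u i\<close> is the vertex of the product at the grid point \<open>u\<close> and the star vertex \<open>i\<close>, where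
  \<open>0\<close> is the centre of the star.
\<close>

lemma no_stack_layout_star_hex_product:
  fixes s :: nat
  defines "S \<equiv> {..s} \<times> {..s}"
  shows "\<exists>n::nat. \<forall>(V :: 'a set) E r \<phi> node. inj_on (case_prod node) (S \<times> {..n}) \<longrightarrow>
    (\<forall>u\<in>S. \<forall>i\<le>n. node u i \<in> V) \<longrightarrow>
    (\<forall>u\<in>S. \<forall>i\<in>{1..n}. {node u 0, node u i} \<in> E) \<longrightarrow>
    (\<forall>(u, v)\<in>hex_edges s. \<forall>i\<le>n. {node u i, node v i} \<in> E) \<longrightarrow>
    \<not> stack_layout s V E r \<phi>"
proof -
  \<comment> \<open>\<open>D\<close> will bound the number of monochromatic edges, hence the walk
    lengths needed; \<open>m\<close> makes room for four indices spaced \<open>D + 1\<close>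
    apart.\<close>
  define D where "D = card (S \<times> S)"
  define m where "m = 3 * (D + 1) + 1"
  define C where "C = Pow (S \<times> {..s}) \<times> Pow (S \<times> S \<times> {..s}) \<times> Pow S"
  have "finite S" by (simp add: S_def)
  then have "finite C" by (simp add: C_def)
  \<comment> \<open>The extra index gives a common partner \<open>a m\<close>, through which the
    colours belonging to single leaves are compared.\<close>
  then obtain n :: nat where n: "\<forall>f. (\<forall>i j. i < j \<longrightarrow> j < n \<longrightarrow> f i j \<in> C) \<longrightarrow>
    (\<exists>a c. (\<forall>i<Suc m. a i < n) \<and> (\<forall>i j. i < j \<longrightarrow> j < Suc m \<longrightarrow> a i < a j \<and> f (a i) (a j) = c))"
    using ramsey_ordered_pairs[of C "Suc m"] by blast
  show ?thesis
  proof (intro exI[of _ n] allI impI notI)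
    fix V :: "'a set" and E r \<phi> node
    assume layout: "stack_layout s V E r \<phi>"
      and inj: "inj_on (case_prod node) (S \<times> {..n})"
      and all_in_V: "\<forall>u\<in>S. \<forall>i\<le>n. node u i \<in> V"
      and all_star: "\<forall>u\<in>S. \<forall>i\<in>{1..n}. {node u 0, node u i} \<in> E"
      and all_hex: "\<forall>(u, v)\<in>hex_edges s. \<forall>i\<le>n. {node u i, node v i} \<in> E"
    have node_V: "node u i \<in> V" if "u \<in> S" "i \<le> n" for u i
      using all_in_V that by blast
    have star: "{node u 0, node u i} \<in> E" if "u \<in> S" "0 < i" "i \<le> n" for u i
      using all_star that by simp
    have hex: "{node u i, node v i} \<in> E" if "(u, v) \<in> hex_edges s" "i \<le> n" for u v i
      using all_hex that by blast
    have colours: "\<phi> e \<in> {1..s}" if "e \<in> E" for e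
      using layout that by (auto simp: stack_layout_def)
    \<comment> \<open>The first two components depend on \<open>i\<close> alone; colourings are
      coded as sets so that \<open>C\<close> is finite. \<open>Suc\<close> skips the centre.\<close>
    define f where "f i j =
      ({(u, c) \<in> S \<times> {..s}. \<phi> {node u 0, node u (Suc i)} = c},
       {(u, v, c) \<in> S \<times> S \<times> {..s}. \<phi> {node u (Suc i), node v (Suc i)} = c},
       {u \<in> S. (node u (Suc i), node u (Suc j)) \<in> r})" for i j
    have "f i j \<in> C" for i j by (auto simp: f_def C_def)
    then have "\<exists>a c. (\<forall>i<Suc m. a i < n) \<and> (\<forall>i j. i < j \<longrightarrow> j < Suc m \<longrightarrow> a i < a j \<and> f (a i) (a j) = c)"
      using n by blast
    then obtain a c where ac: "\<forall>i<Suc m. a i < n"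
      "\<forall>i j. i < j \<longrightarrow> j < Suc m \<longrightarrow> a i < a j \<and> f (a i) (a j) = c"
      by (elim exE conjE) (rule that)
    then have a: "\<And>i. i < Suc m \<Longrightarrow> a i < n"
      and a_less: "\<And>i j. i < j \<Longrightarrow> j < Suc m \<Longrightarrow> a i < a j"
      and fc: "\<And>i j. i < j \<Longrightarrow> j < Suc m \<Longrightarrow> f (a i) (a j) = c"
      by simp_all
    define p where "p u i = node u (Suc (a i))" for u i
    have node_eq: "node u i = node v j \<longleftrightarrow> u = v \<and> i = j"
      if "u \<in> S" "v \<in> S" "i \<le> n" "j \<le> n" for u v i j
      using inj that unfolding inj_on_def by fastforce
    have an: "Suc (a i) \<le> n" if "i < m" for i using a[of i] that by simp
    have star_colour: "\<phi> {node u 0, p u i} = \<phi> {node u 0, p u j}"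
      if "u \<in> S" "i < m" "j < m" for u i j
    proof -
      have "fst (f (a i) (a m)) = fst (f (a j) (a m))"
        using fc[of i m] fc[of j m] that by simp
      moreover have "(u, \<phi> {node u 0, p u i}) \<in> fst (f (a i) (a m))"
        using that colours[OF star[of u "Suc (a i)"]] an by (simp add: f_def p_def)
      ultimately show ?thesis by (simp add: f_def p_def)
    qed
    have hex_colour: "\<phi> {p u i, p v i} = \<phi> {p u j, p v j}"
      if "(u, v) \<in> hex_edges s" "i < m" "j < m" for u v i j
    proof -
      have "u \<in> S" "v \<in> S" using that(1) by (auto simp: hex_edges_def S_def)
      have "fst (snd (f (a i) (a m))) = fst (snd (f (a j) (a m)))"
        using fc[of i m] fc[of j m] that by simp
      moreover have "(u, v, \<phi> {p u i, p v i}) \<in> fst (snd (f (a i) (a m)))"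
        using that \<open>u \<in> S\<close> \<open>v \<in> S\<close> colours[OF hex[of u v "Suc (a i)"]] an
        by (simp add: f_def p_def)
      ultimately show ?thesis by (simp add: f_def p_def)
    qed
    define B where "B u \<longleftrightarrow> u \<in> snd (snd c)" for u
    have B: "B u \<longleftrightarrow> (p u i, p u j) \<in> r" if "u \<in> S" "i < j" "j < m" for u i j
      using fc[of i j, symmetric] that by (simp add: B_def f_def p_def)
    let ?A = "monochromatic_edges s B"
    have "(\<lambda>u. \<phi> {node u 0, p u 0}) ` ({..s} \<times> {..s}) \<subseteq> {1..s}"
    proof (rule image_subsetI)
      fix u assume "u \<in> {..s} \<times> {..s}"
      then show "\<phi> {node u 0, p u 0} \<in> {1..s}"
        using colours[OF star[of u "Suc (a 0)"]] an[of 0] by (simp add: p_def S_def m_def)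
    qed
    then obtain u v where uv: "u \<in> S" "v \<in> S" "u \<noteq> v"
      "\<phi> {node u 0, p u 0} = \<phi> {node v 0, p v 0}" "(u, v) \<in> ?A\<^sup>*"
      unfolding S_def by (rule hex_pigeonhole)
    \<comment> \<open>If the leaves at \<open>u\<close> are in decreasing order, reversing the
      indices makes them increase at every point coloured like \<open>u\<close>.\<close>
    define \<rho> where "\<rho> i = (if B u then i else m - 1 - i)" for i
    have \<rho>: "\<rho> i < m" if "i < m" for i using that by (auto simp: \<rho>_def)
    define q where "q w i = p w (\<rho> i)" for w i
    have increasing: "(q w i, q w j) \<in> r" if "w \<in> S" "B w = B u" "i < j" "j < m" for w i j
    proof (cases "B u")
      case True
      then show ?thesis using B[of w i j] that by (simp add: q_def \<rho>_def)
    next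
      case False
      let ?i = "m - 1 - i" and ?j = "m - 1 - j"
      have ij: "?j < ?i" "?i < m" using that by auto
      then have "(p w ?j, p w ?i) \<notin> r" using B[of w ?j ?i] False that by simp
      moreover have "p w ?j \<noteq> p w ?i"
        using node_eq[of w w "Suc (a ?j)" "Suc (a ?i)"] an[of ?j] an[of ?i] a_less[of ?j ?i] ij that(1)
        unfolding p_def by linarith
      moreover have "p w ?j \<in> V" "p w ?i \<in> V"
        using node_V an ij that(1) by (simp_all add: p_def)
      ultimately have "(p w ?i, p w ?j) \<in> r"
        using stack_layout_total[OF layout] by blast
      then show ?thesis
        using False by (simp add: q_def \<rho>_def)
    qed
    have q_neq: "q w i \<noteq> q w' j" if "w \<in> S" "w' \<in> S" "w \<noteq> w'" "i < m" "j < m" for w w' i j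
      using node_eq an \<rho> that by (simp add: q_def p_def)
    have adjacent: "(q w i, q w' j) \<in> r"
      if "(w, w') \<in> ?A" "B w = B u" "i < j" "j < m" for w w' i j
    proof (rule stack_layout_adjacent_copies[OF layout])
      have ww': "w \<in> S" "w' \<in> S" "w \<noteq> w'" "B w' = B u"
        using that(1,2) by (auto simp: monochromatic_edges_def hex_edges_def S_def)
      have edge_cases: "(w, w') \<in> hex_edges s \<or> (w', w) \<in> hex_edges s"
        using that(1) by (auto simp: monochromatic_edges_def)
      have edge: "{q w k, q w' k} \<in> E" if "k < m" for k
        using edge_cases hex an[OF \<rho>[OF that]] unfolding q_def p_def by (metis insert_commute)
      show "{q w i, q w' i} \<in> E" "{q w j, q w' j} \<in> E"
        using edge that by auto
      have "\<rho> i < m" "\<rho> j < m" using \<rho> that by auto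
      with edge_cases show "\<phi> {q w i, q w' i} = \<phi> {q w j, q w' j}"
        using hex_colour[of w w' "\<rho> i" "\<rho> j"] hex_colour[of w' w "\<rho> i" "\<rho> j"]
        by (auto simp: q_def insert_commute)
      show "(q w i, q w j) \<in> r" "(q w' i, q w' j) \<in> r"
        using increasing ww' that by auto
      show "q w i \<noteq> q w' j"
        using q_neq ww' that by simp
    qed
    \<comment> \<open>Each edge of the walk costs one leaf index.\<close>
    have walk: "(q w i, q w' j) \<in> r \<and> B w' = B u"
      if "(w, w') \<in> ?A ^^ d" "w \<in> S" "B w = B u" "i + d < j" "j < m" for w w' d i j
      using that
    proof (induction d arbitrary: w' j)
      case 0
      then show ?case using increasing by simp
    next
      case (Suc d)
      then obtain w'' where w'': "(w, w'') \<in> ?A ^^ d" "(w'', w') \<in> ?A" by auto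
      then have IH: "(q w i, q w'' (j - 1)) \<in> r" "B w'' = B u"
        using Suc.IH[of w'' "j - 1"] Suc.prems by auto
      moreover have "B w' = B w''"
        using w''(2) by (simp add: monochromatic_edges_def)
      moreover have "(q w'' (j - 1), q w' j) \<in> r"
        using adjacent[OF w''(2)] IH Suc.prems by simp
      ultimately show ?case
        using stack_layout_trans[OF layout] by blast
    qed
    have "?A \<subseteq> S \<times> S" "finite (S \<times> S)"
      using monochromatic_edges_subset[of s B] \<open>finite S\<close> by (simp_all add: S_def)
    then have "finite ?A" "card ?A \<le> D"
      unfolding D_def by (blast intro: finite_subset card_mono)+
    \<comment> \<open>Connected points are joined by a walk of at most \<open>card ?A\<close> edges,
      so a gap above \<open>D\<close> always suffices.\<close>
    then have far: "(q w i, q w' j) \<in> r \<and> B w' = B u"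
      if reach: "(w, w') \<in> ?A\<^sup>*" and "w \<in> S" "B w = B u" "i + D < j" "j < m" for w w' i j
    proof -
      obtain d where "d \<le> card ?A" "(w, w') \<in> ?A ^^ d"
        using reach rtrancl_finite_eq_relpow[OF \<open>finite ?A\<close>] by auto
      with walk[of w w' d i j] that \<open>card ?A \<le> D\<close> show ?thesis by simp
    qed
    have vu: "(v, u) \<in> ?A\<^sup>*"
      using uv(5) sym_rtrancl[OF sym_monochromatic_edges] by (meson symE)
    have Bv: "B v = B u"
      using far[OF uv(5), of 0 "D + 1"] uv(1) by (simp add: m_def)
    have centre: "{node w 0, q w i} \<in> E" "\<phi> {node w 0, q w i} = \<phi> {node w 0, p w 0}"
      "w' \<in> S \<Longrightarrow> q w i \<noteq> node w' 0" if "w \<in> S" "i < m" for w w' i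
      using that star an \<rho> node_eq star_colour[of w "\<rho> i" 0] by (auto simp: q_def p_def)
    \<comment> \<open>The four columns alternate between the two points at multiples of
      \<open>D + 1\<close>. Applied in both directions, this leaves two distinct centres
      incomparable.\<close>
    have "(node w 0, node w' 0) \<notin> r"
      if "w \<in> S" "w' \<in> S" "B w = B u" "B w' = B u" "(w, w') \<in> ?A\<^sup>*" "(w', w) \<in> ?A\<^sup>*"
        "\<phi> {node w 0, p w 0} = \<phi> {node w' 0, p w' 0}" for w w'
      using that far centre
      by (intro stack_layout_four_columns[OF layout, of _ "q w 0" "q w (2 * (D + 1))" _
          "q w' (D + 1)" "q w' (3 * (D + 1))" "\<phi> {node w 0, p w 0}"])
        (auto simp: m_def)
    from this[of u v] this[of v u] have "(node u 0, node v 0) \<notin> r" "(node v 0, node u 0) \<notin> r"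
      using uv vu Bv by auto
    then show False
      using stack_layout_total[OF layout] node_V[of u 0] node_V[of v 0] node_eq[of u v 0 0] uv by auto
  qed
qed

section \<open>The product of a star and a triangular grid\<close>

text \<open>
  The product has vertices \<open>(x * M + y) * k + i\<close> with a grid point \<open>(x, y)\<close> and a star vertex
  \<open>i < k\<close>; the grid is closed up to a helix.
\<close>

definition star_hex_edges :: "nat \<Rightarrow> nat \<Rightarrow> nat set set" where
  "star_hex_edges M k =
     {{g * k, g * k + i} | g i. g < M * M \<and> 0 < i \<and> i < k} \<union>
     {{a, a + d} | a d. d \<in> {k, M * k, (M + 1) * k} \<and> a + d < M * M * k}"

lemma star_hex_graph:
  assumes "0 < M" "0 < k"
  shows "finite_simple_graph {..<M * M * k} (star_hex_edges M k)"
proof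
  fix e assume "e \<in> star_hex_edges M k"
  then consider (star) g i where "e = {g * k, g * k + i}" "g < M * M" "0 < i" "i < k"
    | (hex) a d where "e = {a, a + d}" "d \<in> {k, M * k, (M + 1) * k}" "a + d < M * M * k"
    unfolding star_hex_edges_def by blast
  then show "e \<subseteq> {..<M * M * k} \<and> card e = 2"
  proof cases
    case star
    have "g * k + i < (g + 1) * k" using star by simp
    also have "\<dots> \<le> M * M * k" using star by (intro mult_right_mono) auto
    finally show ?thesis using star by auto
  next
    case hex
    then show ?thesis using assms by auto
  qed
qed simp

text \<open>Edges of equal length never nest. Edges shorter than \<open>k\<close> are star edges,
  which start at multiples of \<open>k\<close>; nested ones would start at different multiples less
  than \<open>k\<close> apart.\<close>

lemma star_hex_queue_number:
  assumes "0 < M" "0 < k"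
  shows "queue_number {..<M * M * k} (star_hex_edges M k) \<le> 4"
proof -
  let ?V = "{..<M * M * k}"
  define r where "r = {(a, b). a \<in> ?V \<and> b \<in> ?V \<and> a < b}"
  \<comment> \<open>For \<open>M = 1\<close> the lengths \<open>k\<close> and \<open>M * k\<close>
    coincide and both get colour 2.\<close>
  define colour where "colour d = (if d < k then 1 else if d = k then 2 else if d = M * k then 3 else 4 :: nat)"
    for d :: nat
  define \<phi> where "\<phi> e = colour (Max e - Min e)" for e :: "nat set"
  have \<phi>: "\<phi> {a, b} = colour (b - a)" if "a < b" for a b
    using that by (simp add: \<phi>_def)
  have edgeD: "b - a \<in> {k, M * k, (M + 1) * k} \<or> b - a < k \<and> k dvd a"
    if "{a, b} \<in> star_hex_edges M k" "a < b" for a b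
  proof -
    from that(1) consider (star) g i where "{a, b} = {g * k, g * k + i}" "i < k"
      | (hex) a' d where "{a, b} = {a', a' + d}" "d \<in> {k, M * k, (M + 1) * k}"
      unfolding star_hex_edges_def by blast
    then show ?thesis
    proof cases
      case star
      with that(2) have "a = g * k" "b = g * k + i" by (auto simp: doubleton_eq_iff)
      with star(2) show ?thesis by simp
    next
      case hex
      with that(2) have "b - a = d" by (auto simp: doubleton_eq_iff)
      with hex(2) show ?thesis by simp
    qed
  qed
  have same_colour: "w - v = y - x \<or> (w - v < k \<and> k dvd v \<and> y - x < k \<and> k dvd x)"
    if "{v, w} \<in> star_hex_edges M k" "{x, y} \<in> star_hex_edges M k" "v < w" "x < y"
      "\<phi> {v, w} = \<phi> {x, y}" for v w x y
  proof -
    have "colour (w - v) = colour (y - x)"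
      using that(5) \<phi>[OF that(3)] \<phi>[OF that(4)] by simp
    moreover have "d = d' \<or> d < k \<and> d' < k"
      if "colour d = colour d'" "d \<in> {k, M * k, (M + 1) * k} \<or> d < k"
        "d' \<in> {k, M * k, (M + 1) * k} \<or> d' < k" for d d'
    proof -
      define K where "K = M * k"
      have "k \<le> K" "(M + 1) * k = K + k" using assms by (auto simp: K_def)
      with that assms(2) show ?thesis
        unfolding colour_def K_def[symmetric] by (auto split: if_splits)
    qed
    moreover have "k \<le> d" if "d \<in> {k, M * k, (M + 1) * k}" for d
      using that assms by auto
    ultimately show ?thesis
      using edgeD[OF that(1,3)] edgeD[OF that(2,4)] by (meson leD)
  qed
  have no_nest: False
    if "{v, w} \<in> star_hex_edges M k" "{x, y} \<in> star_hex_edges M k"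
      "\<phi> {v, w} = \<phi> {x, y}" "v < x" "x < y" "y < w" for v w x y
  proof -
    have "w - v < k" "k dvd v" "k dvd x"
      using same_colour[of v w x y] that by auto
    then have "k dvd x - v" "0 < x - v" "x - v < k"
      using that by auto
    then show False by (meson nat_dvd_not_less)
  qed
  have "queue_layout 4 ?V (star_hex_edges M k) r \<phi>"
    unfolding queue_layout_def
  proof (intro conjI ballI impI)
    show "r \<subseteq> ?V \<times> ?V" by (auto simp: r_def)
    show "strict_linear_order_on ?V r"
      by (auto simp: r_def strict_linear_order_on_def total_on_def intro: transI irreflI)
    show "\<phi> ` star_hex_edges M k \<subseteq> {1..4}"
      by (auto simp: \<phi>_def colour_def)
    fix e f assume ef: "e \<in> star_hex_edges M k" "f \<in> star_hex_edges M k" "\<phi> e = \<phi> f"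
    show "\<not> nest r e f"
    proof
      assume "nest r e f"
      then obtain v w x y where "e = {v, w}" "f = {x, y}"
        "v < x \<and> x < y \<and> y < w \<or> x < v \<and> v < w \<and> w < y"
        unfolding nest_def r_def by blast
      then show False
        using ef no_nest[of v w x y] no_nest[of x y v w] by auto
    qed
  qed
  then show ?thesis
    unfolding queue_number_def by (blast intro: Least_le)
qed

text \<open>The numbered graph realizes the abstract product. Since the stack number is attained and
  layouts persist when stacks are added, excluding \<open>s\<close> stacks bounds it from
  below.\<close>

lemma star_hex_stack_number: "\<exists>k>0. stack_number {..<Suc s * Suc s * k} (star_hex_edges (Suc s) k) > s"
proof -
  let ?M = "Suc s"
  let ?S = "{..s} \<times> {..s}"
  obtain n :: nat where n: "\<forall>(V :: nat set) E r \<phi> node. inj_on (case_prod node) (?S \<times> {..n}) \<longrightarrow>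
    (\<forall>u\<in>?S. \<forall>i\<le>n. node u i \<in> V) \<longrightarrow>
    (\<forall>u\<in>?S. \<forall>i\<in>{1..n}. {node u 0, node u i} \<in> E) \<longrightarrow>
    (\<forall>(u, v)\<in>hex_edges s. \<forall>i\<le>n. {node u i, node v i} \<in> E) \<longrightarrow>
    \<not> stack_layout s V E r \<phi>"
    using no_stack_layout_star_hex_product[of s] by blast
  define k where "k = Suc n"
  let ?V = "{..<?M * ?M * k}" and ?E = "star_hex_edges ?M k"
  have False if le: "stack_number ?V ?E \<le> s"
  proof -
    interpret finite_simple_graph ?V ?E
      by (rule star_hex_graph) (auto simp: k_def)
    obtain r \<phi> where layout: "stack_layout s ?V ?E r \<phi>"
      using stack_number_attained stack_layout_mono[OF _ le] by blast
    define node where "node u i = (fst u * ?M + snd u) * k + i" for u :: "nat \<times> nat" and i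
    have point: "x * ?M + y < ?M * ?M" if "x \<le> s" "y \<le> s" for x y
    proof -
      have "x * ?M + y < (x + 1) * ?M" using that by simp
      also have "\<dots> \<le> ?M * ?M" using that by (intro mult_right_mono) auto
      finally show ?thesis .
    qed
    have node_V: "node u i \<in> ?V" if "u \<in> {..s} \<times> {..s}" "i \<le> n" for u i
    proof -
      have "node u i < (fst u * ?M + snd u + 1) * k"
        using that by (simp add: node_def k_def)
      also have "\<dots> \<le> ?M * ?M * k"
        using point[of "fst u" "snd u"] that by (intro mult_right_mono) auto
      finally show ?thesis by simp
    qed
    \<comment> \<open>A vertex number has mixed-radix digits, recovered by \<open>div\<close> and
      \<open>mod\<close>.\<close>
    have "inj_on (case_prod node) (?S \<times> {..n})"
    proof (rule inj_on_inverseI)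
      fix z assume "z \<in> ?S \<times> {..n}"
      then show "(\<lambda>a. ((a div k div ?M, a div k mod ?M), a mod k)) (case_prod node z) = z"
        by (auto simp: node_def k_def simp del: mult_Suc_right)
    qed
    moreover have "{node u 0, node u i} \<in> ?E" if "u \<in> ?S" "i \<in> {1..n}" for u i
    proof -
      have "fst u * ?M + snd u < ?M * ?M" "0 < i" "i < k"
        using point that by (auto simp: k_def)
      then show ?thesis
        unfolding star_hex_edges_def node_def add_0_right by blast
    qed
    moreover have "{node u i, node v i} \<in> ?E" if uv: "(u, v) \<in> hex_edges s" and "i \<le> n" for u v i
    proof -
      \<comment> \<open>A step in the second coordinate adds \<open>k\<close>, one in the first adds
        \<open>?M * k\<close>, and a diagonal step adds both.\<close>
      obtain d where "d \<in> {k, ?M * k, (?M + 1) * k}" "node v i = node u i + d"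
      proof -
        have "node v i = node u i + k \<or> node v i = node u i + ?M * k \<or> node v i = node u i + (?M + 1) * k"
          using uv by (auto simp: hex_edges_def node_def algebra_simps)
        then show thesis using that by blast
      qed
      moreover have "node v i < ?M * ?M * k"
        using node_V[of v i] uv \<open>i \<le> n\<close> by (auto simp: hex_edges_def)
      ultimately show ?thesis unfolding star_hex_edges_def by auto
    qed
    ultimately have "\<not> stack_layout s ?V ?E r \<phi>"
      using node_V
      by (intro n[THEN spec[of _ ?V], THEN spec[of _ ?E], THEN spec[of _ r], THEN spec[of _ \<phi>],
            THEN spec[of _ node], THEN mp, THEN mp, THEN mp, THEN mp]) blast+
    with layout show False by contradiction
  qed
  then have "s < stack_number ?V ?E" using not_le by blast
  moreover have "0 < k" by (simp add: k_def)
  ultimately show ?thesis by blast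
qed

theorem theorem1:
  fixes s :: nat
  shows "\<exists>(V :: nat set) E. finite_simple_graph V E \<and>
           queue_number V E \<le> 4 \<and> stack_number V E > s"
  using star_hex_stack_number[of s] star_hex_graph[of "Suc s"] star_hex_queue_number[of "Suc s"]
  by blast

end
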